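(* Let $p,q,r\in[1,\infty]$ and let $g(t)=2^{d/4}e^{-\pi|t|^2}$, $t\in\mathbb{R}^d$. If there exists $C>0$ such that the anti-Wick operators $A^{g,g}_{1\otimes m}$ satisfy $$\|A^{g,g}_{1\otimes m}f\|_{L^q(\mathbb{R}^d)}\le C\,\|m\|_{L^{r,\infty}(\mathbb{R}^d)}\,\|f\|_{L^p(\mathbb{R}^d)}\qquad\text{for all } f,m\in\mathcal{S}(\mathbb{R}^d),$$ then $$\frac1q\le\frac1r+\frac1p .$$
   Context: With $T_xf(t)=f(t-x)$, $M_\omega f(t)=e^{2\pi i t\cdot\omega}f(t)$, the short-time Fourier transform is $V_gf(x,\omega)=\int_{\mathbb{R}^d} f(y)\overline{g(y-x)}e^{-2\pi i y\cdot\omega}dy$. The STFT multiplier with symbol $a$ and windows $g_1,g_2$ is $A^{g_1,g_2}_af(t)=\int_{\mathbb{R}^{2d}}a(x,\omega)V_{g_1}f(x,\omega)M_\omega T_xg_2(t)\,dx\,d\omega$; it is called an anti-Wick operator when both windows equal the Gaussian $g$. The symbol $1\otimes m$ is $(1\otimes m)(x,\omega)=m(\omega)$. For $r\in[1,\infty)$, $\|f\|_{L^{r,\infty}}=\sup_{\alpha>0}\alpha\,\mu(\{t\in\mathbb{R}^d:|f(t)|>\alpha\})^{1/r}$ with $\mu$ Lebesgue measure; $L^{\infty,\infty}:=L^\infty$; $1/\infty=0$. *)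

theory Defs
  imports "HOL-Analysis.Analysis" "HOL-Probability.Essential_Supremum"
begin

text \<open>
  Schwartz functions. Only lists of standard basis vectors are used below, so
  \<open>iter_partial\<close> ranges over the partial derivatives of all orders, with repetition and
  in any order. Requiring each of them to be (Frechet) differentiable everywhere is smoothness
  (every partial derivative is then also continuous), and makes the choice in
  \<^const>\<open>frechet_derivative\<close> unique.
\<close>

primrec iter_partial ::
  "'a::euclidean_space list \<Rightarrow> ('a \<Rightarrow> 'b::real_normed_vector) \<Rightarrow> 'a \<Rightarrow> 'b" where
  "iter_partial [] f = f"
| "iter_partial (v # vs) f = (\<lambda>x. frechet_derivative (iter_partial vs f) (at x) v)"

definition schwartz :: "('a::euclidean_space \<Rightarrow> complex) \<Rightarrow> bool" where
  "schwartz f \<longleftrightarrow>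
     (\<forall>vs. set vs \<subseteq> Basis \<longrightarrow>
        (\<forall>x. iter_partial vs f differentiable (at x)) \<and>
        (\<forall>k::nat. \<exists>B. \<forall>x. norm x ^ k * norm (iter_partial vs f x) \<le> B))"

text \<open>
  Norms take values in \<open>[0, \<infinity>]\<close>, and so do the exponents. The power is only used with
  exponent \<open>a > 0\<close>.
\<close>

definition ennreal_power :: "ennreal \<Rightarrow> real \<Rightarrow> ennreal" where
  "ennreal_power x a = (if x = \<infinity> then \<infinity> else ennreal (enn2real x powr a))"

text \<open>
  The norms are meant for Borel measurable functions: \<^const>\<open>lborel\<close> is Lebesgue measure
  restricted to the Borel sets.
\<close>

definition Lp_norm ::
  "ennreal \<Rightarrow> ('a::euclidean_space \<Rightarrow> 'b::real_normed_vector) \<Rightarrow> ennreal" where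
  "Lp_norm p f =
     (if p = \<infinity> then esssup lborel (\<lambda>t. ennreal (norm (f t)))
      else ennreal_power (\<integral>\<^sup>+ t. ennreal (norm (f t) powr enn2real p) \<partial>lborel)
             (1 / enn2real p))"

definition weak_Lp_norm ::
  "ennreal \<Rightarrow> ('a::euclidean_space \<Rightarrow> 'b::real_normed_vector) \<Rightarrow> ennreal" where
  "weak_Lp_norm r f =
     (if r = \<infinity> then Lp_norm \<infinity> f
      else (SUP \<alpha>\<in>{0<..}. ennreal \<alpha> *
              ennreal_power (emeasure lborel {t. norm (f t) > \<alpha>}) (1 / enn2real r)))"

definition translation :: "'a::euclidean_space \<Rightarrow> ('a \<Rightarrow> complex) \<Rightarrow> 'a \<Rightarrow> complex" where
  "translation x f t = f (t - x)"

definition modulation :: "'a::euclidean_space \<Rightarrow> ('a \<Rightarrow> complex) \<Rightarrow> 'a \<Rightarrow> complex" where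
  "modulation \<omega> f t = exp (2 * pi * \<i> * of_real (t \<bullet> \<omega>)) * f t"

definition stft ::
  "('a::euclidean_space \<Rightarrow> complex) \<Rightarrow> ('a \<Rightarrow> complex) \<Rightarrow> 'a \<Rightarrow> 'a \<Rightarrow> complex" where
  "stft g f x \<omega> = (\<integral>y. f y * cnj (g (y - x)) * exp (- 2 * pi * \<i> * of_real (y \<bullet> \<omega>)) \<partial>lborel)"

text \<open>The variable \<open>z = (x, \<omega>)\<close> runs over phase space.\<close>

definition stft_multiplier ::
  "('a::euclidean_space \<Rightarrow> complex) \<Rightarrow> ('a \<Rightarrow> complex) \<Rightarrow> ('a \<times> 'a \<Rightarrow> complex) \<Rightarrow>
   ('a \<Rightarrow> complex) \<Rightarrow> 'a \<Rightarrow> complex" where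
  "stft_multiplier g1 g2 a f t =
     (\<integral>z. a z * stft g1 f (fst z) (snd z) * modulation (snd z) (translation (fst z) g2) t \<partial>lborel)"

definition gaussian :: "'a::euclidean_space \<Rightarrow> complex" where
  "gaussian t = of_real (2 powr (real DIM('a) / 4) * exp (- pi * (norm t)\<^sup>2))"

definition one_tensor :: "('a \<Rightarrow> complex) \<Rightarrow> 'a \<times> 'a \<Rightarrow> complex" where
  "one_tensor m = (\<lambda>(x, \<omega>). m \<omega>)"

definition anti_wick ::
  "('a::euclidean_space \<times> 'a \<Rightarrow> complex) \<Rightarrow> ('a \<Rightarrow> complex) \<Rightarrow> 'a \<Rightarrow> complex" where
  "anti_wick a = stft_multiplier gaussian gaussian a"

end

theory Submission
  imports Defs "HOL-Probability.Characteristic_Functions"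
begin

text \<open>
  By Fubini, \<open>A(1 \<otimes> m)\<close> is the integral operator with kernel
  \<open>M(t - y) * (\<integral> g(t - x) g(y - x) dx)\<close>, where \<open>M\<close> is the Fourier transform of \<open>m\<close>. This kernel
  depends only on \<open>t - y\<close>, and a nonzero translation-invariant operator is bounded from \<open>L\<^sup>p\<close> to
  \<open>L\<^sup>q\<close> only if \<open>p \<le> q\<close>; so even \<open>1/q \<le> 1/p\<close> holds. Concretely, for the one symbol
  \<open>m(\<omega>) = exp(-|\<omega>|\<^sup>2/2)\<close> the kernel is positive, and with \<open>f(t) = exp(-|t|\<^sup>2/L\<^sup>2)\<close> the output is
  bounded below on the ball of radius \<open>L\<close>, uniformly in \<open>L \<ge> 1\<close>. The assumed estimate then gives
  \<open>L\<^bsup>d/q\<^esup> \<le> K L\<^bsup>d/p\<^esup>\<close>, and \<open>L \<rightarrow> \<infinity>\<close> yields the claim.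
\<close>

subsection \<open>Gaussian integrals\<close>

text \<open>The free parameter \<open>a\<close> lets one family serve three roles:
  \<open>a = pi\<close> is the window up to its constant, \<open>a = 1/2\<close> the symbol, and
  \<open>a = 1 / L^2\<close> the functions fed to the operator.\<close>

definition gauss :: "real \<Rightarrow> 'a::euclidean_space \<Rightarrow> real" where
  "gauss a x = exp (- a * (norm x)\<^sup>2)"

lemma gauss_pos [simp]: "0 < gauss a x" "0 \<le> gauss a x" "gauss a x \<noteq> 0"
  by (simp_all add: gauss_def)

lemma continuous_on_gauss [continuous_intros]:
  "continuous_on A f \<Longrightarrow> continuous_on A (\<lambda>x. gauss a (f x))"
  unfolding gauss_def by (intro continuous_intros)

lemma borel_measurable_gauss [measurable]: "gauss a \<in> borel_measurable borel"
  by (intro borel_measurable_continuous_onI continuous_intros)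

lemma gauss_prod: "gauss a x = (\<Prod>b\<in>Basis. exp (- a * (x \<bullet> b)\<^sup>2))"
  unfolding gauss_def power2_norm_eq_inner
  by (subst euclidean_inner) (simp add: sum_distrib_left power2_eq_square exp_sum[symmetric])

lemma has_bochner_integral_gauss_real:
  assumes "0 < a"
  shows "has_bochner_integral lborel (\<lambda>x::real. exp (- a * x\<^sup>2)) (sqrt (pi / a))"
proof -
  \<comment> \<open>The normal density of variance \<open>1 / (2 * a)\<close> is a multiple of the
    integrand, and its total mass 1 then gives the value.\<close>
  define \<sigma> where "\<sigma> = 1 / sqrt (2 * a)"
  have \<sigma>: "0 < \<sigma>" "\<sigma>\<^sup>2 = 1 / (2 * a)"
    using assms by (simp_all add: \<sigma>_def power_divide)
  have "has_bochner_integral lborel (\<lambda>x. sqrt (2 * pi * \<sigma>\<^sup>2) * normal_density 0 \<sigma> x)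
          (sqrt (2 * pi * \<sigma>\<^sup>2) * 1)"
    using \<sigma> by (intro has_bochner_integral_mult_right) (simp add: has_bochner_integral_iff)
  also have "(\<lambda>x. sqrt (2 * pi * \<sigma>\<^sup>2) * normal_density 0 \<sigma> x) = (\<lambda>x. exp (- a * x\<^sup>2))"
    using assms \<sigma> by (simp add: normal_density_def fun_eq_iff)
  also have "sqrt (2 * pi * \<sigma>\<^sup>2) * 1 = sqrt (pi / a)"
    using \<sigma> by simp
  finally show ?thesis .
qed

lemma nn_integral_gauss:
  assumes "0 < a"
  shows "(\<integral>\<^sup>+(x::'a::euclidean_space). ennreal (gauss a x) \<partial>lborel) = ennreal (sqrt (pi / a) ^ DIM('a))"
proof -
  have *: "(\<integral>\<^sup>+(x::real). ennreal (exp (- a * x\<^sup>2)) \<partial>lborel) = ennreal (sqrt (pi / a))"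
    by (subst nn_integral_eq_integral)
       (use has_bochner_integral_gauss_real[OF assms] in \<open>auto simp: has_bochner_integral_iff\<close>)
  have "(\<integral>\<^sup>+(x::'a). ennreal (gauss a x) \<partial>lborel)
      = (\<integral>\<^sup>+(x::'a). (\<Prod>b\<in>Basis. ennreal (exp (- a * (x \<bullet> b)\<^sup>2))) \<partial>lborel)"
    by (simp add: gauss_prod prod_ennreal)
  also have "\<dots> = (\<Prod>b\<in>(Basis::'a set). \<integral>\<^sup>+x. ennreal (exp (- a * x\<^sup>2)) \<partial>lborel)"
    by (rule nn_integral_lborel_prod) auto
  also have "\<dots> = ennreal (sqrt (pi / a) ^ DIM('a))"
    unfolding * prod_constant using assms by (simp add: ennreal_power)
  finally show ?thesis .
qed

lemma integrable_gauss:
  assumes "0 < a"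
  shows "integrable lborel (gauss a :: 'a::euclidean_space \<Rightarrow> real)"
  using nn_integral_gauss[OF assms, where 'a='a] by (intro integrableI_bounded) auto

text \<open>The integrability test for the oscillating integrands below: continuity supplies
  measurability, so only a pointwise Gaussian bound is left to check.\<close>

lemma integrable_gauss_dominated:
  fixes F :: "'a::euclidean_space \<Rightarrow> 'b::{banach, second_countable_topology}"
  assumes "continuous_on UNIV F" "0 < a" "\<And>x. norm (F x) \<le> C * gauss a x"
  shows "integrable lborel F"
proof (rule Bochner_Integration.integrable_bound)
  show "integrable lborel (\<lambda>x::'a. C * gauss a x)"
    using integrable_gauss[OF assms(2), where 'a='a] by simp
  show "F \<in> borel_measurable lborel"
    using assms(1) by (simp add: borel_measurable_continuous_onI)
  show "AE x in lborel. norm (F x) \<le> norm (C * gauss a x)"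
    using assms(3) by (intro AE_I2) (metis abs_ge_self order_trans real_norm_def)
qed

text \<open>This is the characteristic function of the standard normal law with the factor
  \<open>1 / sqrt (2 * pi)\<close> cleared; hence the width \<open>1/2\<close>.\<close>

lemma integral_iexp_gauss_real:
  "(\<integral>x. of_real (exp (- (1/2) * x\<^sup>2)) * exp (\<i> * of_real (x * t)) \<partial>lborel)
    = complex_of_real (sqrt (2 * pi) * exp (- t\<^sup>2 / 2))" for t :: real
proof -
  have "complex_of_real (exp (- t\<^sup>2 / 2)) = char std_normal_distribution t"
    by (simp add: char_std_normal_distribution)
  also have "\<dots> = (\<integral>x. std_normal_density x *\<^sub>R iexp (t * x) \<partial>lborel)"
    unfolding char_def
    by (subst integral_density) (auto simp: normal_density_nonneg)
  also have "\<dots> = (\<integral>x. (1 / sqrt (2 * pi)) *\<^sub>R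
      (of_real (exp (- (1/2) * x\<^sup>2)) * exp (\<i> * of_real (x * t))) \<partial>lborel)"
    by (intro Bochner_Integration.integral_cong refl)
       (simp add: normal_density_def scaleR_conv_of_real mult_ac)
  also have "\<dots> = (1 / sqrt (2 * pi)) *\<^sub>R
      (\<integral>x. of_real (exp (- (1/2) * x\<^sup>2)) * exp (\<i> * of_real (x * t)) \<partial>lborel)"
    by (rule integral_scaleR_right)
  finally show ?thesis
    by (simp add: scaleR_conv_of_real field_simps)
qed

text \<open>Gaussian and character both factor over coordinates, and \<open>lborel\<close> is the
  image of a product of one-dimensional Lebesgue measures, so the integral is a product of
  one-dimensional ones.\<close>

lemma integral_iexp_gauss:
  fixes t :: "'a::euclidean_space"
  shows "(\<integral>x. of_real (gauss (1/2) x) * exp (\<i> * of_real (x \<bullet> t)) \<partial>lborel)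
    = complex_of_real (sqrt (2 * pi) ^ DIM('a) * gauss (1/2) t)"
proof -
  interpret product_sigma_finite "\<lambda>_::'a. lborel :: real measure" ..
  let ?h = "\<lambda>b x. complex_of_real (exp (- (1/2) * x\<^sup>2)) * exp (\<i> * of_real (x * (t \<bullet> b)))"
  have gauss: "complex_of_real (gauss (1/2) x) = (\<Prod>b\<in>Basis. of_real (exp (- (1/2) * (x \<bullet> b)\<^sup>2)))" for x :: 'a
    unfolding gauss_prod by (rule of_real_prod)
  have int: "integrable lborel (?h b)" for b
    by (rule integrable_gauss_dominated[where a="1/2" and C=1])
       (auto intro!: continuous_intros simp: norm_mult gauss_def)
  have "(\<integral>x. of_real (gauss (1/2) x) * exp (\<i> * of_real (x \<bullet> t)) \<partial>lborel)
      = (\<integral>x. (\<Prod>b\<in>Basis. ?h b (x \<bullet> b)) \<partial>(lborel :: 'a measure))"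
    by (intro Bochner_Integration.integral_cong refl)
       (simp add: gauss prod.distrib exp_sum sum_distrib_left euclidean_inner[of _ t])
  also have "\<dots> = (\<integral>x. (\<Prod>b\<in>Basis. ?h b (x b)) \<partial>(\<Pi>\<^sub>M b\<in>(Basis::'a set). lborel))"
    by (subst lborel_eq, subst integral_distr) (auto intro!: Bochner_Integration.integral_cong prod.cong)
  also have "\<dots> = (\<Prod>b\<in>(Basis::'a set). integral\<^sup>L lborel (?h b))"
    by (rule product_integral_prod) (use int in auto)
  also have "\<dots> = (\<Prod>b\<in>(Basis::'a set). complex_of_real (sqrt (2 * pi) * exp (- (1/2) * (t \<bullet> b)\<^sup>2)))"
    by (intro prod.cong refl) (subst integral_iexp_gauss_real, simp)
  also have "\<dots> = complex_of_real (sqrt (2 * pi) ^ DIM('a) * gauss (1/2) t)"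
    unfolding gauss_prod of_real_prod[symmetric] prod.distrib prod_constant by simp
  finally show ?thesis .
qed

subsection \<open>Gaussians are Schwartz functions\<close>

text \<open>Induction over the generation of polynomials, with the product rule for
  \<open>mult\<close>. Polynomiality is stated for each fixed direction \<open>v\<close> because
  \<open>iter_partial\<close> differentiates in one direction at a time.\<close>

lemma real_polynomial_function_has_derivative:
  fixes p :: "'a::euclidean_space \<Rightarrow> real"
  assumes "real_polynomial_function p"
  shows "\<exists>D. (\<forall>x. (p has_derivative D x) (at x)) \<and> (\<forall>v. real_polynomial_function (\<lambda>x. D x v))"
  using assms
proof induction
  case (linear f)
  then show ?case
    by (intro exI[of _ "\<lambda>_. f"]) (auto intro: bounded_linear_imp_has_derivative)
next
  case (const c)
  then show ?case
    by (intro exI[of _ "\<lambda>_ _. 0"]) auto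
next
  case (add f g)
  then obtain D E where
    "\<And>x. (f has_derivative D x) (at x)" "\<And>v. real_polynomial_function (\<lambda>x. D x v)"
    "\<And>x. (g has_derivative E x) (at x)" "\<And>v. real_polynomial_function (\<lambda>x. E x v)"
    by blast
  then show ?case
    by (intro exI[of _ "\<lambda>x v. D x v + E x v"]) (auto intro!: derivative_intros)
next
  case (mult f g)
  then obtain D E where
    "\<And>x. (f has_derivative D x) (at x)" "\<And>v. real_polynomial_function (\<lambda>x. D x v)"
    "\<And>x. (g has_derivative E x) (at x)" "\<And>v. real_polynomial_function (\<lambda>x. E x v)"
    by blast
  moreover from this have "real_polynomial_function (\<lambda>x. f x * E x v + D x v * g x)" for v
    using mult.hyps by (intro real_polynomial_function.intros(3,4))
  ultimately show ?case
    by (intro exI[of _ "\<lambda>x v. f x * E x v + D x v * g x"]) (auto intro!: derivative_intros)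
qed

text \<open>The base \<open>1 + norm x\<close> is at least 1, so in the sum case both powers can be
  raised to the common exponent \<open>k + l\<close>.\<close>

lemma real_polynomial_function_growth:
  assumes "real_polynomial_function p"
  shows "\<exists>C n. \<forall>x. \<bar>p x\<bar> \<le> C * (1 + norm x) ^ n"
  using assms
proof induction
  case (linear f)
  then obtain K where K: "0 < K" "\<And>x. \<bar>f x\<bar> \<le> norm x * K"
    by (metis bounded_linear.pos_bounded real_norm_def)
  have "\<bar>f x\<bar> \<le> K * (1 + norm x) ^ 1" for x
    using K(1) K(2)[of x] by (simp add: algebra_simps)
  then show ?case by blast
next
  case (const c)
  have "\<bar>c\<bar> \<le> \<bar>c\<bar> * (1 + norm x) ^ 0" for x :: 'a by simp
  then show ?case by blast
next
  case (add f g)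
  then obtain A k B l where A: "\<And>x. \<bar>f x\<bar> \<le> A * (1 + norm x) ^ k"
    and B: "\<And>x. \<bar>g x\<bar> \<le> B * (1 + norm x) ^ l" by blast
  have "A \<ge> 0" "B \<ge> 0"
    using A[of 0] B[of 0] by auto
  have "\<bar>f x + g x\<bar> \<le> (A + B) * (1 + norm x) ^ (k + l)" for x
  proof -
    have "A * (1 + norm x) ^ k \<le> A * (1 + norm x) ^ (k + l)"
         "B * (1 + norm x) ^ l \<le> B * (1 + norm x) ^ (k + l)"
      using \<open>A \<ge> 0\<close> \<open>B \<ge> 0\<close> by (auto intro!: mult_left_mono power_increasing)
    with A[of x] B[of x] show ?thesis by (simp add: algebra_simps)
  qed
  then show ?case by blast
next
  case (mult f g)
  then obtain A k B l where A: "\<And>x. \<bar>f x\<bar> \<le> A * (1 + norm x) ^ k"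
    and B: "\<And>x. \<bar>g x\<bar> \<le> B * (1 + norm x) ^ l" by blast
  have "A \<ge> 0" "B \<ge> 0"
    using A[of 0] B[of 0] by auto
  have "\<bar>f x * g x\<bar> \<le> (A * B) * (1 + norm x) ^ (k + l)" for x
  proof -
    have "\<bar>f x\<bar> * \<bar>g x\<bar> \<le> (A * (1 + norm x) ^ k) * (B * (1 + norm x) ^ l)"
      using \<open>A \<ge> 0\<close> by (intro mult_mono A B) auto
    then show ?thesis by (simp add: abs_mult power_add mult_ac)
  qed
  then show ?case by blast
qed

lemma polynomial_gauss_bounded:
  fixes p :: "'a::euclidean_space \<Rightarrow> real"
  assumes p: "real_polynomial_function p" and "0 < a"
  shows "\<exists>B. \<forall>x. norm x ^ k * \<bar>p x * gauss a x\<bar> \<le> B"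
proof -
  obtain C n where C: "\<And>x. \<bar>p x\<bar> \<le> C * (1 + norm x) ^ n"
    using real_polynomial_function_growth[OF p] by blast
  define N where "N = real (k + n)"
  have "C \<ge> 0" using C[of 0] by auto
  have "norm x ^ k * \<bar>p x * gauss a x\<bar> \<le> C * exp (N\<^sup>2 / (4 * a))" for x
  proof -
    have "norm x ^ k * \<bar>p x\<bar> \<le> (1 + norm x) ^ k * (C * (1 + norm x) ^ n)"
      by (intro mult_mono C power_mono) auto
    also have "\<dots> = C * (1 + norm x) ^ (k + n)"
      by (simp add: power_add)
    \<comment> \<open>From \<open>1 + s \<le> exp s\<close>, polynomial growth becomes
      \<open>exp (N * norm x)\<close>; completing the square against the Gaussian exponent then
      yields a bound free of \<open>x\<close>.\<close>
    also have "\<dots> \<le> C * exp (norm x) ^ (k + n)"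
      using \<open>C \<ge> 0\<close> by (intro mult_left_mono power_mono) auto
    also have "\<dots> = C * exp (N * norm x)"
      by (simp only: N_def exp_of_nat_mult)
    finally have "norm x ^ k * \<bar>p x\<bar> * gauss a x \<le> C * exp (N * norm x) * gauss a x"
      by (intro mult_right_mono) auto
    also have "\<dots> = C * exp (N * norm x - a * (norm x)\<^sup>2)"
      by (simp add: gauss_def exp_add[symmetric])
    also have "N * norm x - a * (norm x)\<^sup>2 = N\<^sup>2 / (4 * a) - a * (norm x - N / (2 * a))\<^sup>2"
      using \<open>0 < a\<close> by (simp add: field_simps power2_eq_square)
    also have "C * exp \<dots> \<le> C * exp (N\<^sup>2 / (4 * a))"
      using \<open>C \<ge> 0\<close> \<open>0 < a\<close> by (intro mult_left_mono) auto
    finally show ?thesis by (simp add: abs_mult mult_ac)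
  qed
  then show ?thesis by blast
qed

lemma polynomial_gauss_has_derivative:
  fixes p :: "'a::euclidean_space \<Rightarrow> real"
  assumes "real_polynomial_function p"
  obtains D where
    "\<And>x. ((\<lambda>x. complex_of_real (p x * gauss a x)) has_derivative
        (\<lambda>v. complex_of_real (D x v * gauss a x))) (at x)"
    "\<And>v. real_polynomial_function (\<lambda>x. D x v)"
proof -
  obtain E where E: "\<And>x. (p has_derivative E x) (at x)"
      "\<And>v. real_polynomial_function (\<lambda>x. E x v)"
    using real_polynomial_function_has_derivative[OF assms] by blast
  \<comment> \<open>Product rule: differentiating the Gaussian in direction \<open>v\<close>
    contributes the linear factor \<open>- 2 * a * (x \<bullet> v)\<close>, so the form polynomial
    times Gaussian is preserved.\<close>
  let ?D = "\<lambda>x v. E x v + (- 2 * a) * (p x * (x \<bullet> v))"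
  show ?thesis
  proof (rule that[of ?D])
    show "((\<lambda>x. complex_of_real (p x * gauss a x)) has_derivative
        (\<lambda>v. complex_of_real (?D x v * gauss a x))) (at x)" for x
      unfolding gauss_def power2_norm_eq_inner
      by (rule has_derivative_of_real, rule has_derivative_eq_rhs)
         (auto intro!: derivative_eq_intros E simp: fun_eq_iff algebra_simps inner_commute)
    show "real_polynomial_function (\<lambda>x. ?D x v)" for v
      by (intro real_polynomial_function.intros(2-4) assms E
          real_polynomial_function.intros(1)[OF bounded_linear_inner_left])
  qed
qed

lemma iter_partial_gauss:
  "\<exists>p. real_polynomial_function p \<and>
     iter_partial vs (\<lambda>x::'a::euclidean_space. complex_of_real (gauss a x))
       = (\<lambda>x. complex_of_real (p x * gauss a x))"
proof (induction vs)
  case Nil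
  show ?case
    by (intro exI[of _ "\<lambda>_. 1"]) (auto simp: fun_eq_iff)
next
  case (Cons v vs)
  then obtain p where p: "real_polynomial_function p"
    "iter_partial vs (\<lambda>x::'a. complex_of_real (gauss a x)) = (\<lambda>x. complex_of_real (p x * gauss a x))"
    by blast
  obtain D where
    D: "\<And>x. ((\<lambda>x. complex_of_real (p x * gauss a x)) has_derivative
        (\<lambda>v. complex_of_real (D x v * gauss a x))) (at x)"
    "\<And>v. real_polynomial_function (\<lambda>x. D x v)"
    using polynomial_gauss_has_derivative[OF p(1)] by blast
  show ?case
    using D(2)[of v] by (intro exI[of _ "\<lambda>x. D x v"])
      (simp add: p(2) frechet_derivative_at[OF D(1), symmetric] del: of_real_mult)
qed

lemma schwartz_gauss:
  assumes "0 < a"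
  shows "schwartz (\<lambda>x::'a::euclidean_space. complex_of_real (gauss a x))"
  unfolding schwartz_def
proof (intro allI impI conjI)
  fix vs :: "'a list" and k :: nat
  obtain p where p: "real_polynomial_function p"
    "iter_partial vs (\<lambda>x::'a. complex_of_real (gauss a x)) = (\<lambda>x. complex_of_real (p x * gauss a x))"
    using iter_partial_gauss by blast
  show "iter_partial vs (\<lambda>x::'a. complex_of_real (gauss a x)) differentiable at x" for x
    unfolding p(2) using polynomial_gauss_has_derivative[OF p(1)] differentiableI by metis
  show "\<exists>B. \<forall>x. norm x ^ k * norm (iter_partial vs (\<lambda>x::'a. complex_of_real (gauss a x)) x) \<le> B"
    using polynomial_gauss_bounded[OF p(1) assms] unfolding p(2) norm_of_real .
qed

subsection \<open>The anti-Wick operator as an integral operator\<close>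

lemma gauss_le_1: "0 \<le> a \<Longrightarrow> gauss a x \<le> 1"
  by (simp add: gauss_def)

lemma gauss_antimono: "a \<le> b \<Longrightarrow> gauss b x \<le> gauss a x"
  by (simp add: gauss_def mult_right_mono)

lemma gauss_ge:
  assumes "0 \<le> a" "norm x \<le> R"
  shows "exp (- a * R\<^sup>2) \<le> gauss a x"
  using assms by (simp add: gauss_def mult_left_mono power_mono)

lemma gauss_Pair: "gauss a (x, y) = gauss a x * gauss a y"
  by (simp add: gauss_def norm_Pair exp_add[symmetric] algebra_simps)

text \<open>Moves the centre from \<open>t\<close> to 0. The inequality
  \<open>|x|^2 \<le> 2 |t - x|^2 + 2 |t|^2\<close> costs half of the decay rate and a constant
  depending on \<open>t\<close>, which is fixed wherever this is used.\<close>

lemma gauss_diff_le: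
  assumes "0 \<le> a"
  shows "gauss a (t - x) \<le> exp (a * (norm t)\<^sup>2) * gauss (a / 2) x"
proof -
  have "norm x \<le> norm (t - x) + norm t"
    by (metis add.commute norm_minus_commute norm_triangle_sub)
  then have "(norm x)\<^sup>2 \<le> (norm (t - x) + norm t)\<^sup>2"
    by (intro power_mono) auto
  also have "\<dots> \<le> 2 * (norm (t - x))\<^sup>2 + 2 * (norm t)\<^sup>2"
    using sum_squares_bound[of "norm (t - x)" "norm t"] by (simp add: power2_sum)
  finally have "a * (norm x)\<^sup>2 \<le> a * (2 * (norm (t - x))\<^sup>2 + 2 * (norm t)\<^sup>2)"
    using assms by (intro mult_left_mono)
  then show ?thesis
    by (simp add: gauss_def exp_add[symmetric] algebra_simps)
qed

lemma integral_lborel_times: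
  fixes u :: "'a::euclidean_space \<Rightarrow> complex" and v :: "'b::euclidean_space \<Rightarrow> complex"
  assumes "integrable lborel (\<lambda>z. u (fst z) * v (snd z))"
  shows "(\<integral>z. u (fst z) * v (snd z) \<partial>lborel) = (\<integral>x. u x \<partial>lborel) * (\<integral>y. v y \<partial>lborel)"
proof -
  have "(\<integral>z. u (fst z) * v (snd z) \<partial>lborel) = (\<integral>x. \<integral>y. u x * v y \<partial>lborel \<partial>lborel)"
    using lborel_pair.integral_fst'[of "\<lambda>z. u (fst z) * v (snd z)"] assms
    by (simp add: lborel_prod)
  then show ?thesis by simp
qed

text \<open>The autocorrelation of the unnormalised window at \<open>t - y\<close>: what remains of
  the two windows after integrating out the position \<open>x\<close>.\<close>

definition gauss_overlap :: "'a::euclidean_space \<Rightarrow> 'a \<Rightarrow> real" where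
  "gauss_overlap t y = (\<integral>x. gauss pi (y - x) * gauss pi (t - x) \<partial>lborel)"

text \<open>The factor containing \<open>y\<close> is bounded by 1, so the majorant is uniform in
  \<open>y\<close>; the other factor is recentred at 0.\<close>

lemma gauss_overlap_dominated:
  "gauss pi (y - x) * gauss pi (t - x) \<le> exp (pi * (norm t)\<^sup>2) * gauss (1/2) x"
proof -
  have "gauss pi (y - x) * gauss pi (t - x) \<le> gauss pi (t - x)"
    using gauss_le_1[of pi "y - x"] by (simp add: mult_le_cancel_right1)
  also have "\<dots> \<le> exp (pi * (norm t)\<^sup>2) * gauss (pi / 2) x"
    by (rule gauss_diff_le) simp
  also have "\<dots> \<le> exp (pi * (norm t)\<^sup>2) * gauss (1/2) x"
    using pi_ge_two by (intro mult_left_mono gauss_antimono) auto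
  finally show ?thesis .
qed

lemma integrable_gauss_overlap:
  "integrable lborel (\<lambda>x::'a::euclidean_space. gauss pi (y - x) * gauss pi (t - x))"
  by (rule integrable_gauss_dominated[where a="1/2"])
     (auto intro!: continuous_intros gauss_overlap_dominated)

text \<open>Only \<open>x\<close> in the unit ball around \<open>t\<close> is kept. There
  \<open>norm (t - x) \<le> 1\<close> and \<open>norm (y - x) \<le> 2\<close>, and the exponents
  \<open>pi * 1\<close> and \<open>pi * 4\<close> add up to \<open>5 * pi\<close>.\<close>

lemma gauss_overlap_ge:
  fixes t y :: "'a::euclidean_space"
  assumes "norm (t - y) \<le> 1"
  shows "exp (- 5 * pi) * unit_ball_vol (real DIM('a)) \<le> gauss_overlap t y"
proof -
  have "exp (- 5 * pi) * unit_ball_vol (real DIM('a))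
      = (\<integral>x. exp (- 5 * pi) * indicator (cball t 1) x \<partial>lborel)"
    by (simp add: content_cball)
  also have "\<dots> \<le> gauss_overlap t y"
    unfolding gauss_overlap_def
  proof (rule integral_mono)
    show "integrable lborel (\<lambda>x. exp (- 5 * pi) * indicator (cball t 1) x :: real)"
      by (simp add: emeasure_cball)
    show "integrable lborel (\<lambda>x. gauss pi (y - x) * gauss pi (t - x))"
      by (rule integrable_gauss_overlap)
    show "exp (- 5 * pi) * indicator (cball t 1) x \<le> gauss pi (y - x) * gauss pi (t - x)" for x
    proof (cases "x \<in> cball t 1")
      case True
      then have *: "norm (t - x) \<le> 1" by (simp add: dist_norm)
      then have "norm (y - x) \<le> 2"
        using norm_triangle_ineq4[of "t - x" "t - y"] assms by simp
      with * have "exp (- pi * 2\<^sup>2) * exp (- pi * 1\<^sup>2) \<le> gauss pi (y - x) * gauss pi (t - x)"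
        by (intro mult_mono gauss_ge) auto
      then show ?thesis using True by (simp add: exp_add[symmetric])
    qed simp
  qed
  finally show ?thesis .
qed

lemma gaussian_eq_gauss:
  "gaussian (t::'a::euclidean_space) = of_real (2 powr (real DIM('a) / 4) * gauss pi t)"
  by (simp add: gaussian_def gauss_def)

text \<open>The kernel for the symbol \<open>gauss (1/2)\<close>: the normalising constants of the
  two windows, the integral over positions, and the Fourier transform of the symbol. The factor
  \<open>2 * pi\<close> in the last argument comes from the convention for modulations.\<close>

definition anti_wick_kernel :: "'a::euclidean_space \<Rightarrow> 'a \<Rightarrow> real" where
  "anti_wick_kernel t y = (2 powr (real DIM('a) / 4))\<^sup>2 * gauss_overlap t y *
     (sqrt (2 * pi) ^ DIM('a) * gauss (1/2) ((2 * pi) *\<^sub>R (t - y)))"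

text \<open>\<open>F z y\<close> is the full integrand, with the integral defining the STFT opened
  up. Fubini moves the integral over phase space inside, where it produces the kernel.\<close>

lemma anti_wick_gauss:
  fixes t :: "'a::euclidean_space"
  assumes "0 < b"
  defines "m \<equiv> (\<lambda>x::'a. complex_of_real (gauss (1/2) x))"
    and "f \<equiv> (\<lambda>x::'a. complex_of_real (gauss b x))"
  shows "integrable lborel (\<lambda>y. gauss b y * anti_wick_kernel t y)"
    and "anti_wick (one_tensor m) f t = of_real (\<integral>y. gauss b y * anti_wick_kernel t y \<partial>lborel)"
proof -
  define K where "K = 2 powr (real DIM('a) / 4)"
  define F where "F z y = m (snd z) * (f y * cnj (gaussian (y - fst z)) *
      exp (- 2 * pi * \<i> * of_real (y \<bullet> snd z))) * modulation (snd z) (translation (fst z) gaussian) t"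
    for z :: "'a \<times> 'a" and y :: 'a
  have g: "gaussian x = of_real (K * gauss pi x)" for x :: 'a
    by (simp add: gaussian_eq_gauss K_def)
  have norm_F: "norm (F z y) =
      K\<^sup>2 * (gauss (1/2) (snd z) * (gauss pi (y - fst z) * gauss pi (t - fst z)) * gauss b y)" for z y
    by (simp add: F_def m_def f_def g modulation_def translation_def norm_mult power2_eq_square
        K_def mult_ac)
  \<comment> \<open>Decay in frequency comes from the symbol, in position from the windows, and in
    \<open>y\<close> from \<open>f\<close>. Weakening all three rates to \<open>min (1/2) b\<close>
    makes the majorant one Gaussian on the product space.\<close>
  have int: "integrable (lborel \<Otimes>\<^sub>M lborel) (\<lambda>(z, y). F z y)"
    unfolding lborel_prod
  proof (rule integrable_gauss_dominated)
    show "continuous_on UNIV (\<lambda>(z, y). F z y)"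
      unfolding F_def m_def f_def g modulation_def translation_def split_def
      by (intro continuous_intros)
    show "0 < min (1/2) b" using assms by simp
    show "norm ((\<lambda>(z, y). F z y) x)
        \<le> K\<^sup>2 * exp (pi * (norm t)\<^sup>2) * gauss (min (1/2) b) x" for x
    proof -
      obtain z \<omega> y where x: "x = ((z, \<omega>), y)" by (metis surj_pair)
      have "norm (F (z, \<omega>) y) =
          K\<^sup>2 * (gauss (1/2) \<omega> * (gauss pi (y - z) * gauss pi (t - z)) * gauss b y)"
        by (simp add: norm_F)
      also have "\<dots> \<le> K\<^sup>2 * (gauss (min (1/2) b) \<omega> *
          (exp (pi * (norm t)\<^sup>2) * gauss (min (1/2) b) z) * gauss (min (1/2) b) y)"
        by (intro mult_mono mult_left_mono gauss_antimono order_trans[OF gauss_overlap_dominated]) auto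
      finally show ?thesis by (simp add: x gauss_Pair mult_ac)
    qed
  qed
  have inner: "(\<integral>z. F z y \<partial>lborel) = of_real (gauss b y * anti_wick_kernel t y)" for y
  proof -
    define u where "u x = complex_of_real (gauss pi (y - x) * gauss pi (t - x))" for x :: 'a
    define v where
      "v \<omega> = of_real (gauss (1/2) \<omega>) * exp (\<i> * of_real (\<omega> \<bullet> ((2 * pi) *\<^sub>R (t - y))))" for \<omega> :: 'a
    have F_eq: "F z y = of_real (gauss b y * K\<^sup>2) * (u (fst z) * v (snd z))" for z
    proof -
      define e where "e = exp (- 2 * pi * \<i> * of_real (y \<bullet> snd z))"
      define e' where "e' = exp (2 * pi * \<i> * of_real (t \<bullet> snd z))"
      \<comment> \<open>The character from the STFT and the one from the modulation combine into one
        depending on \<open>t - y\<close>; for fixed \<open>y\<close> the integrand therefore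
        separates into a position factor \<open>u\<close> and a frequency factor
        \<open>v\<close>.\<close>
      have "e * e' = exp (\<i> * of_real (snd z \<bullet> ((2 * pi) *\<^sub>R (t - y))))"
        unfolding e_def e'_def exp_add[symmetric]
        by (rule arg_cong[where f=exp])
           (simp add: inner_diff_right inner_commute[of _ "snd z"] algebra_simps)
      then have v: "v (snd z) = of_real (gauss (1/2) (snd z)) * (e * e')"
        by (simp add: v_def)
      show ?thesis
        unfolding F_def modulation_def translation_def m_def f_def g v u_def
          e_def[symmetric] e'_def[symmetric]
        by (simp add: power2_eq_square mult_ac)
    qed
    have "integrable lborel (\<lambda>z. u (fst z) * v (snd z))"
    proof (rule integrable_gauss_dominated)
      show "continuous_on UNIV (\<lambda>z. u (fst z) * v (snd z))"
        unfolding u_def v_def by (intro continuous_intros)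
      show "norm (u (fst z) * v (snd z)) \<le> exp (pi * (norm t)\<^sup>2) * gauss (1/2) z" for z
        using mult_right_mono[OF gauss_overlap_dominated[of y "fst z" t], of "gauss (1/2) (snd z)"]
        by (cases z) (simp add: u_def v_def norm_mult gauss_Pair mult_ac)
    qed simp
    then have "(\<integral>z. F z y \<partial>lborel) = of_real (gauss b y * K\<^sup>2) *
        ((\<integral>x. u x \<partial>lborel) * (\<integral>\<omega>. v \<omega> \<partial>lborel))"
      unfolding F_eq by (simp add: integral_lborel_times)
    also have "(\<integral>x. u x \<partial>lborel) = of_real (gauss_overlap t y)"
      unfolding u_def gauss_overlap_def by (rule integral_complex_of_real)
    also have "(\<integral>\<omega>. v \<omega> \<partial>lborel)
        = of_real (sqrt (2 * pi) ^ DIM('a) * gauss (1/2) ((2 * pi) *\<^sub>R (t - y)))"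
      unfolding v_def by (rule integral_iexp_gauss)
    finally show ?thesis
      by (simp add: anti_wick_kernel_def K_def mult_ac)
  qed
  have "integrable lborel (\<lambda>y. complex_of_real (gauss b y * anti_wick_kernel t y))"
    using lborel_pair.integrable_snd[OF int] unfolding inner .
  then show "integrable lborel (\<lambda>y. gauss b y * anti_wick_kernel t y)"
    by (simp only: complex_of_real_integrable_eq)
  have "anti_wick (one_tensor m) f t = (\<integral>z. \<integral>y. F z y \<partial>lborel \<partial>lborel)"
    unfolding anti_wick_def stft_multiplier_def stft_def F_def one_tensor_def split_def
    by simp
  also have "\<dots> = (\<integral>y. \<integral>z. F z y \<partial>lborel \<partial>lborel)"
    by (rule lborel_pair.Fubini_integral[OF int, symmetric])
  finally show "anti_wick (one_tensor m) f t =
      of_real (\<integral>y. gauss b y * anti_wick_kernel t y \<partial>lborel)"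
    unfolding inner integral_complex_of_real .
qed

section \<open>Lower bounds for the kernel and for the operator's output\<close>

lemma anti_wick_kernel_nonneg: "0 \<le> anti_wick_kernel t y"
  unfolding anti_wick_kernel_def gauss_overlap_def by simp

text \<open>Near the diagonal the overlap is bounded below by \<open>gauss_overlap_ge\<close>, and
  the Fourier factor is evaluated at a point of norm at most \<open>2 * pi\<close>.\<close>

lemma anti_wick_kernel_lower_bound:
  "\<exists>c>0. \<forall>t y :: 'a::euclidean_space. norm (t - y) \<le> 1 \<longrightarrow> c \<le> anti_wick_kernel t y"
proof -
  let ?c = "(2 powr (real DIM('a) / 4))\<^sup>2 * (exp (- 5 * pi) * unit_ball_vol (real DIM('a))) *
     (sqrt (2 * pi) ^ DIM('a) * exp (- (1/2) * (2 * pi)\<^sup>2))"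
  have "?c \<le> anti_wick_kernel t y" if "norm (t - y) \<le> 1" for t y :: 'a
    unfolding anti_wick_kernel_def using that gauss_overlap_ge[OF that]
    by (intro mult_mono gauss_ge) (auto simp: gauss_overlap_def)
  moreover have "0 < ?c" by simp
  ultimately show ?thesis by blast
qed

text \<open>The kernel is nonnegative, so the integral may be restricted to the unit ball around
  \<open>t\<close>. As \<open>L \<ge> 1\<close>, every \<open>y\<close> there has norm at most
  \<open>L + 1 \<le> 2 * L\<close>, where the input is at least \<open>exp (- 4)\<close>; hence
  \<open>c\<close> does not depend on \<open>L\<close>.\<close>

lemma anti_wick_gauss_lower_bound:
  "\<exists>c>0. \<forall>L\<ge>1. \<forall>t::'a::euclidean_space. norm t \<le> L \<longrightarrow>
     c \<le> norm (anti_wick (one_tensor (\<lambda>x. of_real (gauss (1/2) x)))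
                   (\<lambda>x. of_real (gauss (1 / L\<^sup>2) x)) t)"
proof -
  obtain c where "0 < c" and c: "\<And>t y :: 'a. norm (t - y) \<le> 1 \<Longrightarrow> c \<le> anti_wick_kernel t y"
    using anti_wick_kernel_lower_bound by blast
  let ?A = "\<lambda>L. anti_wick (one_tensor (\<lambda>x. of_real (gauss (1/2) x)))
                   (\<lambda>x::'a. of_real (gauss (1 / L\<^sup>2) x))"
  let ?V = "unit_ball_vol (real DIM('a))"
  have "exp (- 4) * c * ?V \<le> norm (?A L t)" if "1 \<le> L" "norm t \<le> L" for L and t :: 'a
  proof -
    have pos: "0 < 1 / L\<^sup>2" using that by simp
    have "exp (- 4) * c * ?V = (\<integral>y. exp (- 4) * c * indicator (cball t 1) y \<partial>lborel)"
      by (simp add: content_cball)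
    also have "\<dots> \<le> (\<integral>y. gauss (1 / L\<^sup>2) y * anti_wick_kernel t y \<partial>lborel)"
    proof (rule integral_mono)
      show "integrable lborel (\<lambda>y. exp (- 4) * c * indicator (cball t 1) y :: real)"
        by (simp add: emeasure_cball)
      show "integrable lborel (\<lambda>y. gauss (1 / L\<^sup>2) y * anti_wick_kernel t y)"
        by (rule anti_wick_gauss(1)[OF pos])
      show "exp (- 4) * c * indicator (cball t 1) y \<le> gauss (1 / L\<^sup>2) y * anti_wick_kernel t y" for y
      proof (cases "y \<in> cball t 1")
        case True
        then have *: "norm (t - y) \<le> 1" by (simp add: dist_norm)
        have "norm y \<le> norm t + norm (t - y)"
          by (metis add.commute norm_minus_commute norm_triangle_sub)
        with * that have "norm y \<le> 2 * L" by simp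
        then have "exp (- (1 / L\<^sup>2) * (2 * L)\<^sup>2) \<le> gauss (1 / L\<^sup>2) y"
          by (intro gauss_ge) auto
        moreover have "- (1 / L\<^sup>2) * (2 * L)\<^sup>2 = - 4"
          using that by (simp add: power_mult_distrib)
        ultimately have "exp (- 4) * c \<le> gauss (1 / L\<^sup>2) y * anti_wick_kernel t y"
          using \<open>0 < c\<close> by (intro mult_mono c *) auto
        then show ?thesis using True by simp
      qed (simp add: anti_wick_kernel_nonneg)
    qed
    also have "\<dots> \<le> norm (?A L t)"
      unfolding anti_wick_gauss(2)[OF pos] norm_of_real by (rule abs_ge_self)
    finally show ?thesis .
  qed
  moreover have "0 < exp (- 4) * c * ?V"
    using \<open>0 < c\<close> by simp
  ultimately show ?thesis by blast
qed

subsection \<open>Strong and weak Lebesgue norms\<close>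

lemma ennreal_power_ennreal: "0 \<le> x \<Longrightarrow> ennreal_power (ennreal x) a = ennreal (x powr a)"
  by (simp add: ennreal_power_def)

lemma ennreal_power_mono:
  assumes "x \<le> y" "0 \<le> a"
  shows "ennreal_power x a \<le> ennreal_power y a"
proof (cases "y = \<infinity>")
  case False
  then have "enn2real x \<le> enn2real y"
    using assms by (intro enn2real_mono) (auto simp: less_top)
  with False assms show ?thesis
    by (auto simp: ennreal_power_def top_unique intro!: ennreal_leI powr_mono2)
qed (simp add: ennreal_power_def)

lemma enn2real_ge_1:
  assumes "1 \<le> p" "p \<noteq> \<infinity>"
  shows "1 \<le> enn2real p"
  using enn2real_mono[OF assms(1)] assms(2) by (simp add: less_top)

text \<open>Reading \<open>1 / p\<close> as a real number, with value 0 at infinity, lets later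
  bounds treat finite and infinite exponents in one formula.\<close>

lemma enn2real_inverse_exponent:
  assumes "1 \<le> p"
  shows "enn2real (1 / p) = (if p = \<infinity> then 0 else 1 / enn2real p)"
proof (cases "p = \<infinity>")
  case False
  then have "p = ennreal (enn2real p)" "1 \<le> enn2real p"
    using enn2real_ge_1[OF assms] by (auto simp: less_top)
  then have "1 / p = ennreal (1 / enn2real p)"
    by (metis divide_ennreal ennreal_1 less_le_trans zero_le_one zero_less_one)
  with False \<open>1 \<le> enn2real p\<close> show ?thesis by simp
qed simp

text \<open>Chebyshev's inequality at each level \<open>\<alpha>\<close>, followed by an
  \<open>s\<close>-th root.\<close>

lemma weak_Lp_norm_le_Lp_norm:
  assumes [measurable]: "f \<in> borel_measurable borel" and "1 \<le> r"
  shows "weak_Lp_norm r f \<le> Lp_norm r f"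
proof (cases "r = \<infinity>")
  case False
  define s where "s = enn2real r"
  have s: "1 \<le> s" using enn2real_ge_1[OF assms(2) False] by (simp add: s_def)
  let ?I = "\<integral>\<^sup>+ t. ennreal (norm (f t) powr s) \<partial>lborel"
  have "ennreal \<alpha> * ennreal_power (emeasure lborel {t. \<alpha> < norm (f t)}) (1 / s) \<le> ennreal_power ?I (1 / s)"
    if "0 < \<alpha>" for \<alpha>
  proof (cases "?I = \<infinity>")
    case False
    then obtain J where J: "0 \<le> J" "?I = ennreal J"
      by (metis ennreal_cases infinity_ennreal_def)
    let ?S = "{t. \<alpha> < norm (f t)}"
    have "ennreal (\<alpha> powr s) * emeasure lborel ?S
        = (\<integral>\<^sup>+ t. ennreal (\<alpha> powr s) * indicator ?S t \<partial>lborel)"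
      by (subst nn_integral_cmult_indicator) auto
    also have "\<dots> \<le> ?I"
      using s that by (intro nn_integral_mono) (auto simp: indicator_def intro!: ennreal_leI powr_mono2)
    finally have *: "ennreal (\<alpha> powr s) * emeasure lborel ?S \<le> ennreal J"
      by (simp add: J)
    \<comment> \<open>An infinite level set would make the left side of \<open>*\<close> infinite,
      since \<open>\<alpha> powr s > 0\<close>. Finiteness allows the root to be taken in the
      reals.\<close>
    have "emeasure lborel ?S \<noteq> \<infinity>"
      using * that by (auto simp: ennreal_mult_top top_unique)
    then obtain M where M: "0 \<le> M" "emeasure lborel ?S = ennreal M"
      by (metis ennreal_cases infinity_ennreal_def)
    have "\<alpha> powr s * M \<le> J"
      using * J M by (simp add: ennreal_mult'[symmetric])
    then have "(\<alpha> powr s * M) powr (1 / s) \<le> J powr (1 / s)"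
      using s M by (intro powr_mono2) auto
    then have "\<alpha> * M powr (1 / s) \<le> J powr (1 / s)"
      using s M that by (simp add: powr_mult powr_powr)
    then show ?thesis
      using that J M by (simp add: ennreal_power_ennreal ennreal_mult'[symmetric])
  qed (simp add: ennreal_power_def)
  with False show ?thesis
    unfolding weak_Lp_norm_def Lp_norm_def s_def by (auto intro!: SUP_least)
qed (simp add: weak_Lp_norm_def)

text \<open>The \<open>s\<close>-th power of \<open>gauss a\<close> is \<open>gauss (s * a)\<close>.
  The resulting factor in \<open>s\<close> is dropped using \<open>s \<ge> 1\<close>, which keeps
  the power of \<open>a\<close> that the scaling argument compares.\<close>

lemma Lp_norm_gauss_le:
  assumes "0 < a" "1 \<le> p"
  shows "Lp_norm p (\<lambda>x::'a::euclidean_space. complex_of_real (gauss a x))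
    \<le> ennreal ((pi / a) powr (real DIM('a) / 2 * enn2real (1 / p)))"
proof (cases "p = \<infinity>")
  case True
  have "esssup lborel (\<lambda>x::'a. ennreal (norm (complex_of_real (gauss a x)))) \<le> 1"
    using assms by (intro esssup_I AE_I2) (auto simp: gauss_def)
  with True assms show ?thesis by (simp add: Lp_norm_def)
next
  case False
  define s where "s = enn2real p"
  have s: "1 \<le> s" using enn2real_ge_1[OF assms(2) False] by (simp add: s_def)
  have "(\<integral>\<^sup>+ (t::'a). ennreal (norm (complex_of_real (gauss a t)) powr s) \<partial>lborel)
      = (\<integral>\<^sup>+ (t::'a). ennreal (gauss (s * a) t) \<partial>lborel)"
    by (simp add: gauss_def powr_def mult_ac)
  also have "\<dots> = ennreal (sqrt (pi / (s * a)) ^ DIM('a))"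
    using assms s by (intro nn_integral_gauss) simp
  also have "\<dots> \<le> ennreal ((pi / a) powr (real DIM('a) / 2))"
  proof -
    have "sqrt (pi / (s * a)) ^ DIM('a) \<le> sqrt (pi / a) ^ DIM('a)"
      using assms s by (intro power_mono) (auto simp: divide_simps mult_le_cancel_right1)
    also have "\<dots> = (pi / a) powr (real DIM('a) / 2)"
      using assms by (simp add: powr_half_sqrt[symmetric] powr_realpow[symmetric] powr_powr)
    finally show ?thesis by (rule ennreal_leI)
  qed
  finally have "ennreal_power (\<integral>\<^sup>+ (t::'a). ennreal (norm (complex_of_real (gauss a t)) powr s) \<partial>lborel) (1 / s)
      \<le> ennreal_power (ennreal ((pi / a) powr (real DIM('a) / 2))) (1 / s)"
    using s by (intro ennreal_power_mono) auto
  with False assms show ?thesis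
    by (simp add: Lp_norm_def ennreal_power_ennreal powr_powr enn2real_inverse_exponent s_def)
qed

text \<open>Restricting the integral to the ball bounds the norm below by \<open>c\<close> times the
  ball's volume to the power \<open>1 / q\<close>; this is the source of the growth of order
  \<open>d / q\<close> in the radius.\<close>

lemma Lp_norm_ge_of_lower_bound_on_cball:
  fixes h :: "'a::euclidean_space \<Rightarrow> 'b::real_normed_vector"
  assumes "1 \<le> q" "q \<noteq> \<infinity>" "0 < c" "0 < R" and c: "\<And>t. norm t \<le> R \<Longrightarrow> c \<le> norm (h t)"
  shows "ennreal (c * (unit_ball_vol (real DIM('a)) * R ^ DIM('a)) powr enn2real (1 / q)) \<le> Lp_norm q h"
proof -
  define s where "s = enn2real q"
  have s: "1 \<le> s" using enn2real_ge_1[OF assms(1,2)] by (simp add: s_def)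
  let ?V = "unit_ball_vol (real DIM('a)) * R ^ DIM('a)"
  have V: "0 < ?V" using assms by simp
  have "ennreal (c powr s * ?V) = (\<integral>\<^sup>+ t. ennreal (c powr s) * indicator (cball (0::'a) R) t \<partial>lborel)"
    using assms by (subst nn_integral_cmult_indicator) (auto simp: emeasure_cball ennreal_mult')
  also have "\<dots> \<le> (\<integral>\<^sup>+ t. ennreal (norm (h t) powr s) \<partial>lborel)"
    using assms s by (intro nn_integral_mono) (auto simp: indicator_def intro!: ennreal_leI powr_mono2)
  finally have "ennreal_power (ennreal (c powr s * ?V)) (1 / s)
      \<le> ennreal_power (\<integral>\<^sup>+ t. ennreal (norm (h t) powr s) \<partial>lborel) (1 / s)"
    using s by (intro ennreal_power_mono) auto
  moreover have "ennreal_power (ennreal (c powr s * ?V)) (1 / s) = ennreal (c * ?V powr (1 / s))"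
    using V s assms by (subst ennreal_power_ennreal) (auto simp: powr_mult powr_powr)
  ultimately show ?thesis
    using assms(1,2) by (simp add: Lp_norm_def enn2real_inverse_exponent s_def)
qed

subsection \<open>The necessary condition\<close>

lemma exponent_le_of_powr_bounded:
  fixes a b A B :: real
  assumes "0 < A" and bound: "\<And>L. 1 \<le> L \<Longrightarrow> A * L powr a \<le> B * L powr b"
  shows "a \<le> b"
proof (rule ccontr)
  assume "\<not> a \<le> b"
  define K where "K = max 1 (B / A) + 1"
  \<comment> \<open>Chosen so that \<open>L powr (a - b) = K\<close>, and \<open>K\<close> exceeds
    \<open>B / A\<close>; the assumed bound fails at this \<open>L\<close>.\<close>
  define L where "L = K powr (1 / (a - b))"
  have "1 \<le> K" by (simp add: K_def)
  then have "1 \<le> L"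
    using \<open>\<not> a \<le> b\<close> by (simp add: L_def ge_one_powr_ge_zero)
  have "L powr a = K * L powr b"
    using \<open>\<not> a \<le> b\<close> \<open>1 \<le> K\<close> powr_add[of L "a - b" b] by (simp add: L_def powr_powr)
  with bound[OF \<open>1 \<le> L\<close>] \<open>1 \<le> L\<close> have "A * K \<le> B"
    by (simp flip: mult.assoc)
  then have "K \<le> B / A"
    using \<open>0 < A\<close> by (simp add: field_simps)
  then show False by (simp add: K_def)
qed

theorem theorem5p3:
  fixes p q r :: ennreal
  assumes "1 \<le> p" and "1 \<le> q" and "1 \<le> r"
    and "\<exists>C::real. C > 0 \<and>
           (\<forall>(f :: real ^ 'd \<Rightarrow> complex) (m :: real ^ 'd \<Rightarrow> complex).
              schwartz f \<longrightarrow> schwartz m \<longrightarrow>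
              Lp_norm q (anti_wick (one_tensor m) f)
                \<le> ennreal C * weak_Lp_norm r m * Lp_norm p f)"
  shows "1 / q \<le> 1 / r + 1 / p"
proof (cases "q = \<infinity>")
  case False
  define d where "d = real DIM(real ^ 'd)"
  define V where "V = unit_ball_vol d"
  define s where "s = enn2real (1 / p)"
  define e where "e = enn2real (1 / q)"
  define m where "m = (\<lambda>x :: real ^ 'd. complex_of_real (gauss (1/2) x))"
  define f where "f L = (\<lambda>x :: real ^ 'd. complex_of_real (gauss (1 / L\<^sup>2) x))" for L :: real
  define W where "W = (pi / (1/2)) powr (d / 2 * enn2real (1 / r))"
  have "0 < d" "0 < V"
    by (simp_all add: d_def V_def)
  obtain C where C: "0 < C" "\<And>f m. schwartz f \<Longrightarrow> schwartz m \<Longrightarrow>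
      Lp_norm q (anti_wick (one_tensor m) f :: real ^ 'd \<Rightarrow> complex)
        \<le> ennreal C * weak_Lp_norm r m * Lp_norm p f"
    using assms(4) by blast
  obtain c where c: "0 < c"
    "\<And>L t. 1 \<le> L \<Longrightarrow> norm t \<le> L \<Longrightarrow> c \<le> norm (anti_wick (one_tensor m) (f L) t)"
    using anti_wick_gauss_lower_bound[where 'a="real ^ 'd"] unfolding m_def f_def by blast
  have weak: "weak_Lp_norm r m \<le> ennreal W"
    unfolding m_def W_def d_def
    by (intro order_trans[OF weak_Lp_norm_le_Lp_norm Lp_norm_gauss_le]) (use assms in auto)
  \<comment> \<open>The left side bounds the output's norm below on the ball of radius
    \<open>L\<close>; the right side is the assumed estimate with the Gaussian norms inserted. Since
    \<open>m\<close> is fixed, \<open>r\<close> enters only through the constant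
    \<open>W\<close>.\<close>
  have bound: "c * V powr e * L powr (d * e) \<le> C * W * pi powr (d / 2 * s) * L powr (d * s)"
    if L: "1 \<le> L" for L :: real
  proof -
    have "ennreal (c * (V * L ^ DIM(real ^ 'd)) powr e) \<le> Lp_norm q (anti_wick (one_tensor m) (f L))"
      unfolding V_def d_def e_def
      using assms(2) False c L by (intro Lp_norm_ge_of_lower_bound_on_cball) auto
    also have "\<dots> \<le> ennreal C * weak_Lp_norm r m * Lp_norm p (f L)"
      unfolding m_def f_def using L by (intro C(2) schwartz_gauss) auto
    also have "\<dots> \<le> ennreal C * ennreal W * ennreal ((pi / (1 / L\<^sup>2)) powr (d / 2 * s))"
      unfolding f_def d_def s_def
      using L assms(1) by (intro mult_mono weak Lp_norm_gauss_le) auto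
    also have "\<dots> = ennreal (C * W * (pi / (1 / L\<^sup>2)) powr (d / 2 * s))"
      using C(1) by (simp add: W_def ennreal_mult')
    finally have "c * (V * L ^ DIM(real ^ 'd)) powr e \<le> C * W * (pi / (1 / L\<^sup>2)) powr (d / 2 * s)"
      using C(1) by (subst (asm) ennreal_le_iff) (auto simp: W_def)
    moreover have "(V * L ^ DIM(real ^ 'd)) powr e = V powr e * L powr (d * e)"
    proof -
      have "L ^ DIM(real ^ 'd) = L powr d"
        using L unfolding d_def by (subst powr_realpow) auto
      then show ?thesis
        using L \<open>0 < V\<close> by (simp add: powr_mult powr_powr)
    qed
    moreover have "(pi / (1 / L\<^sup>2)) powr (d / 2 * s) = pi powr (d / 2 * s) * L powr (d * s)"
    proof -
      have "pi / (1 / L\<^sup>2) = pi * L powr 2"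
        using L by simp
      then show ?thesis
        using L by (simp add: powr_mult powr_powr mult_ac del: powr_numeral)
    qed
    ultimately show ?thesis by (simp add: mult_ac)
  qed
  have "d * e \<le> d * s"
    by (rule exponent_le_of_powr_bounded[OF _ bound]) (use \<open>0 < c\<close> \<open>0 < V\<close> in auto)
  then have "e \<le> s"
    using \<open>0 < d\<close> by simp
  \<comment> \<open>For \<open>x \<ge> 1\<close> the reciprocal is finite, so
    \<open>enn2real\<close>, which sends infinity to 0, loses nothing here.\<close>
  moreover have "1 / x = ennreal (enn2real (1 / x))" if "1 \<le> x" for x :: ennreal
    using that by (intro ennreal_enn2real[symmetric]) (auto simp: divide_ennreal_def less_top[symmetric])
  ultimately have "1 / q \<le> 1 / p"
    using assms(1,2) unfolding e_def s_def by (metis ennreal_leI)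
  then show ?thesis
    by (simp add: add_increasing)
\<comment> \<open>For \<open>q = \<infinity>\<close> the left side \<open>1 / q\<close> is
  0.\<close>
qed simp

end
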